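(* Let $\Gamma=(W,F,\succ_W,\succ_F)$ be a (discrete, many-to-one) matching market. If the firms' demand type $\mathcal{D}=\bigcup_{f\in F}\mathcal{D}_f$ is totally unimodular, then there exists a stable matching in $\Gamma$.
   Context: A matching market $\Gamma=(W,F,\succ_W,\succ_F)$ consists of a finite set of firms $F=\{f_1,\dots,f_m\}$, a finite set of workers $W=\{w_1,\dots,w_n\}$, a null firm $\o$ (meaning "unmatched"), with $\widetilde F=F\cup\{\o\}$; each worker $w$ has a strict, complete, transitive preference $\succ_w$ over $\widetilde F$ (write $f\succeq_w f'$ if $f\succ_w f'$ or $f=f'$); each firm $f\in F$ has a strict, complete, transitive preference $\succ_f$ over $2^W$ (write $S\succeq_f S'$ if $S\succ_f S'$ or $S=S'$). The choice function $Ch_f$ of $f$ maps $S\subseteq W$ to the unique $Ch_f(S)\subseteq S$ with $Ch_f(S)\succeq_f S'$ for all $S'\subseteq S$. A matching is a map $\mu$ with $\mu(w)\in\widetilde F$ for every $w\in W$, $\mu(f)\subseteq W$ for every $f\in\widetilde F$, and $\mu(w)=f$ iff $w\in\mu(f)$. A matching $\mu$ is individually rational if $\mu(w)\succeq_w\o$ for all $w\in W$ and $\mu(f)=Ch_f(\mu(f))$ for all $f\in F$. A firm $f\in F$ and a set $S\subseteq W$ form a blocking coalition for $\mu$ if $f\succeq_w\mu(w)$ for all $w\in S$ and $S\succ_f\mu(f)$. A matching is stable if it is individually rational and no blocking coalition exists. For $S\subseteq W$, $ind(S)\in\{0,1\}^W$ is its indicator vector. The demand type of firm $f$ is $\mathcal{D}_f=\{\mathbf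 d\in\{-1,0,1\}^W : \mathbf d\neq\mathbf 0,\ \mathbf d=ind(Ch_f(S))-ind(Ch_f(S'))\text{ for some } S'\subsetneq S\subseteq W\}$, and the firms' demand type is $\mathcal{D}=\bigcup_{f\in F}\mathcal{D}_f$. A set of vectors is totally unimodular if the matrix having these vectors as columns is totally unimodular (every square submatrix has determinant $0$ or $\pm1$). *)

theory Defs
  imports Main "Jordan_Normal_Form.Determinant"
begin

(* Workers: type 'w (finite); firms: type 'f (finite); the null firm is None,
   so \<widetilde>F = 'f option.
   prefW w : strict preference relation of worker w over 'f option ((x,y) \<in> prefW w iff x \<succ>_w y).
   prefF f : strict preference relation of firm f over 2^W. *)

definition strict_total :: "('a \<times> 'a) set \<Rightarrow> bool" where
  "strict_total r \<longleftrightarrow> irrefl r \<and> trans r \<and> total r"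

definition weak_pref :: "('a \<times> 'a) set \<Rightarrow> 'a \<Rightarrow> 'a \<Rightarrow> bool" where
  "weak_pref r x y \<longleftrightarrow> (x, y) \<in> r \<or> x = y"

definition Ch :: "('f \<Rightarrow> ('w set \<times> 'w set) set) \<Rightarrow> 'f \<Rightarrow> 'w set \<Rightarrow> 'w set" where
  "Ch prefF f S = (THE T. T \<subseteq> S \<and> (\<forall>T'. T' \<subseteq> S \<longrightarrow> weak_pref (prefF f) T T'))"

(* a matching is represented by the map w \<mapsto> \<mu>(w) \<in> 'f option; \<mu>(f) = {w. \<mu> w = Some f} *)
definition assigned :: "('w \<Rightarrow> 'f option) \<Rightarrow> 'f \<Rightarrow> 'w set" where
  "assigned \<mu> f = {w. \<mu> w = Some f}"

definition individually_rational ::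
  "('w \<Rightarrow> ('f option \<times> 'f option) set) \<Rightarrow> ('f \<Rightarrow> ('w set \<times> 'w set) set) \<Rightarrow> ('w \<Rightarrow> 'f option) \<Rightarrow> bool" where
  "individually_rational prefW prefF \<mu> \<longleftrightarrow>
     (\<forall>w. weak_pref (prefW w) (\<mu> w) None) \<and>
     (\<forall>f. Ch prefF f (assigned \<mu> f) = assigned \<mu> f)"

definition blocking_coalition ::
  "('w \<Rightarrow> ('f option \<times> 'f option) set) \<Rightarrow> ('f \<Rightarrow> ('w set \<times> 'w set) set) \<Rightarrow> ('w \<Rightarrow> 'f option) \<Rightarrow> 'f \<Rightarrow> 'w set \<Rightarrow> bool" where
  "blocking_coalition prefW prefF \<mu> f S \<longleftrightarrow>
     (\<forall>w\<in>S. weak_pref (prefW w) (Some f) (\<mu> w)) \<and> (S, assigned \<mu> f) \<in> prefF f"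

definition stable ::
  "('w \<Rightarrow> ('f option \<times> 'f option) set) \<Rightarrow> ('f \<Rightarrow> ('w set \<times> 'w set) set) \<Rightarrow> ('w \<Rightarrow> 'f option) \<Rightarrow> bool" where
  "stable prefW prefF \<mu> \<longleftrightarrow> individually_rational prefW prefF \<mu> \<and>
     \<not> (\<exists>f S. blocking_coalition prefW prefF \<mu> f S)"

definition ind :: "'w set \<Rightarrow> 'w \<Rightarrow> int" where
  "ind S = (\<lambda>w. if w \<in> S then 1 else 0)"

definition demand_type_firm :: "('f \<Rightarrow> ('w set \<times> 'w set) set) \<Rightarrow> 'f \<Rightarrow> ('w \<Rightarrow> int) set" where
  "demand_type_firm prefF f = {d. (\<forall>w. d w \<in> {-1, 0, 1}) \<and> d \<noteq> (\<lambda>_. 0) \<and>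
      (\<exists>S S'. S' \<subset> S \<and> d = (\<lambda>w. ind (Ch prefF f S) w - ind (Ch prefF f S') w))}"

definition demand_type :: "('f \<Rightarrow> ('w set \<times> 'w set) set) \<Rightarrow> ('w \<Rightarrow> int) set" where
  "demand_type prefF = (\<Union>f. demand_type_firm prefF f)"

definition totally_unimodular :: "('w \<Rightarrow> int) set \<Rightarrow> bool" where
  "totally_unimodular V \<longleftrightarrow>
     (\<forall>(k::nat) (r::nat \<Rightarrow> 'w) (c::nat \<Rightarrow> ('w \<Rightarrow> int)).
        inj_on r {..<k} \<longrightarrow> inj_on c {..<k} \<longrightarrow> c ` {..<k} \<subseteq> V \<longrightarrow>
        det (mat k k (\<lambda>(i, j). c j (r i))) \<in> {-1, 0, 1})"

end

theory Submission
  imports "HOL-Analysis.Brouwer_Fixpoint" "HOL-Analysis.Cartesian_Euclidean_Space" Defs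
begin

text \<open>A fractional matching distributes mass over the deals (firm, team) and over being unmatched.
  A stable one exists by Brouwer's theorem. If its support is minimal, it is the only solution of
  the feasibility equations on its support. For a firm \<open>f\<close>, each team \<open>S\<close> in the support is the choice
  of \<open>f\<close> from the set of workers it could attract at the level of \<open>S\<close>. These sets form a chain, so
  \<open>ind S - ind (L f)\<close> lies in the demand type, where \<open>L f\<close> is the worst team of \<open>f\<close> in the
  support. The masses of the teams other than \<open>L f\<close> are thus the unique solution of an integral
  system with totally unimodular columns, hence integers by Cramer's rule. Since each
  such mass would lie strictly between 0 and 1, every firm has a single team, and the
  matching is integral.\<close>

section \<open>Fractional stability from Brouwer's theorem\<close>

lemma finite_total_preorder_greatest:
  assumes "finite A" "A \<noteq> {}"
    and "\<And>x y. x \<in> A \<Longrightarrow> y \<in> A \<Longrightarrow> P x y \<or> P y x"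
    and "\<And>x y z. P x y \<Longrightarrow> P y z \<Longrightarrow> P x z"
  shows "\<exists>m\<in>A. \<forall>x\<in>A. P m x"
  using assms(1,2,3)
proof (induction A rule: finite_ne_induct)
  case (singleton x)
  then show ?case by auto
next
  case (insert a A)
  then obtain m where m: "m \<in> A" "\<forall>x\<in>A. P m x" by blast
  have refl: "P a a" using insert.prems[of a a] by blast
  show ?case
  proof (cases "P m a")
    case True
    then show ?thesis using m by blast
  next
    case False
    then have "P a m" using insert.prems[of a m] m(1) by blast
    then show ?thesis using m(2) refl assms(4) by blast
  qed
qed

lemma continuous_on_Max_image:
  fixes f :: "'i \<Rightarrow> 'a::topological_space \<Rightarrow> 'b::linorder_topology"
  assumes "finite I" "I \<noteq> {}" "\<And>i. i \<in> I \<Longrightarrow> continuous_on X (f i)"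
  shows "continuous_on X (\<lambda>x. Max ((\<lambda>i. f i x) ` I))"
  using assms
proof (induction I rule: finite_ne_induct)
  case (singleton i)
  then show ?case by simp
next
  case (insert i I)
  then have "(\<lambda>x. Max ((\<lambda>i. f i x) ` insert i I)) = (\<lambda>x. max (f i x) (Max ((\<lambda>i. f i x) ` I)))"
    by (simp add: Max_insert)
  then show ?case using insert by (auto intro!: continuous_on_max)
qed

text \<open>The conditions are the complementarity problem \<open>x j \<ge> 0\<close>, \<open>h j \<ge> 1\<close>,
  \<open>x j * (h j - 1) = 0\<close>, where \<open>h j\<close> is the largest mass that a row of \<open>j\<close> puts on columns at
  least as good as \<open>j\<close>. Solutions are the fixed points of the clipped map
  \<open>x j \<mapsto> x j + 1 - h j\<close> on the unit cube.\<close>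

lemma exists_fractional_stable:
  fixes rows :: "'j::finite \<Rightarrow> 'i set"
    and weakly_worse :: "'i \<Rightarrow> 'j \<Rightarrow> 'j \<Rightarrow> bool"
  assumes fin: "\<And>j. finite (rows j)" and ne: "\<And>j. rows j \<noteq> {}"
    and tot: "\<And>i j j'. i \<in> rows j \<Longrightarrow> i \<in> rows j' \<Longrightarrow> weakly_worse i j j' \<or> weakly_worse i j' j"
    and trans: "\<And>i j j' j''. weakly_worse i j j' \<Longrightarrow> weakly_worse i j' j'' \<Longrightarrow> weakly_worse i j j''"
  shows "\<exists>x :: 'j \<Rightarrow> real. (\<forall>j. 0 \<le> x j) \<and> (\<forall>i. (\<Sum>j | i \<in> rows j. x j) \<le> 1) \<and>
    (\<forall>j. \<exists>i\<in>rows j. (\<Sum>j' | i \<in> rows j'. x j') = 1 \<and>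
      (\<forall>j'. i \<in> rows j' \<and> x j' \<noteq> 0 \<longrightarrow> weakly_worse i j j'))"
proof -
  define a where "a i j x = (\<Sum>j' | i \<in> rows j' \<and> weakly_worse i j j'. vec_nth x j')"
    for i j and x :: "real ^ 'j"
  define h where "h j x = Max ((\<lambda>i. a i j x) ` rows j)" for j x
  define \<phi> where "\<phi> x = (\<chi> j. max 0 (min 1 (vec_nth x j + 1 - h j x)))" for x
  have cont: "continuous_on X \<phi>" for X
  proof -
    have "continuous_on X (a i j)" for i j
      unfolding a_def by (intro continuous_intros)
    then have "continuous_on X (h j)" for j
      unfolding h_def using fin ne by (intro continuous_on_Max_image)
    then show ?thesis
      unfolding \<phi>_def by (intro continuous_on_vec_lambda continuous_on_max continuous_on_min continuous_intros)
  qed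
  have in_cube: "x \<in> cbox 0 1 \<longleftrightarrow> (\<forall>j. 0 \<le> vec_nth x j \<and> vec_nth x j \<le> 1)" for x :: "real ^ 'j"
    by (auto simp: mem_box_cart)
  have "\<phi> \<in> cbox 0 1 \<rightarrow> cbox 0 1"
    by (auto simp: in_cube \<phi>_def)
  moreover have "(0 :: real ^ 'j) \<in> cbox 0 1" by (simp add: in_cube)
  ultimately obtain x where x: "x \<in> cbox 0 1" "\<phi> x = x"
    using brouwer[OF compact_cbox convex_box(1) _ cont] by blast
  have fixp: "vec_nth x j = max 0 (min 1 (vec_nth x j + 1 - h j x))" for j
    using arg_cong[OF x(2), of "\<lambda>v. vec_nth v j"] by (simp add: \<phi>_def)
  have nonneg: "0 \<le> vec_nth x j" for j using x(1) by (simp add: in_cube)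
  have a_le_h: "a i j x \<le> h j x" if "i \<in> rows j" for i j
    using that fin by (auto simp: h_def)
  have refl: "weakly_worse i j j" if "i \<in> rows j" for i j using tot[OF that that] by blast
  have x_le_h: "vec_nth x j \<le> h j x" for j
  proof -
    obtain i where i: "i \<in> rows j" using ne by blast
    have "vec_nth x j \<le> a i j x"
      unfolding a_def by (rule member_le_sum) (use i refl nonneg in auto)
    then show ?thesis using a_le_h[OF i] by linarith
  qed
  \<comment> \<open>If \<open>h j x < 1\<close>, the clipped map strictly raises coordinate
    \<open>j\<close> unless it is already 1, and then \<open>x_le_h\<close> gives
    \<open>h j x \<ge> 1\<close>.\<close>
  have h_ge: "1 \<le> h j x" for j
    using fixp[of j] x_le_h[of j] by (auto simp: max_def min_def split: if_splits)
  have h_le: "h j x \<le> 1" if "vec_nth x j \<noteq> 0" for j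
    using fixp[of j] that by (auto simp: max_def min_def split: if_splits)
  have feas: "(\<Sum>j | i \<in> rows j. vec_nth x j) \<le> 1" for i
  proof (cases "{j. i \<in> rows j \<and> vec_nth x j \<noteq> 0} = {}")
    case True
    then have "(\<Sum>j | i \<in> rows j. vec_nth x j) = 0" by (intro sum.neutral) auto
    then show ?thesis by simp
  next
    case False
    \<comment> \<open>Take \<open>m\<close> as the worst support column of row \<open>i\<close>: the
      whole mass of the row then counts in \<open>a i m x\<close>, which is at most
      \<open>h m x \<le> 1\<close>.\<close>
    have "\<exists>m\<in>{j. i \<in> rows j \<and> vec_nth x j \<noteq> 0}.
        \<forall>j\<in>{j. i \<in> rows j \<and> vec_nth x j \<noteq> 0}. weakly_worse i m j"
      by (rule finite_total_preorder_greatest[OF _ False]) (simp, use tot in simp, erule (1) trans)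
    then obtain m where m: "i \<in> rows m" "vec_nth x m \<noteq> 0"
      and least: "\<And>j. i \<in> rows j \<Longrightarrow> vec_nth x j \<noteq> 0 \<Longrightarrow> weakly_worse i m j"
      by blast
    have "(\<Sum>j | i \<in> rows j. vec_nth x j) = a i m x"
      unfolding a_def by (rule sum.mono_neutral_right) (use least in auto)
    then show ?thesis using a_le_h[OF m(1)] h_le[OF m(2)] by linarith
  qed
  have "\<exists>i\<in>rows j. (\<Sum>j' | i \<in> rows j'. vec_nth x j') = 1 \<and>
      (\<forall>j'. i \<in> rows j' \<and> vec_nth x j' \<noteq> 0 \<longrightarrow> weakly_worse i j j')" for j
  proof -
    have "h j x \<in> (\<lambda>i. a i j x) ` rows j"
      unfolding h_def using fin ne by (intro Max_in) auto
    then obtain i where i: "i \<in> rows j" "1 \<le> a i j x" using h_ge[of j] by auto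
    let ?B = "{j'. i \<in> rows j' \<and> \<not> weakly_worse i j j'}"
    have split: "(\<Sum>j' | i \<in> rows j'. vec_nth x j') = a i j x + sum (vec_nth x) ?B"
      unfolding a_def by (subst sum.union_disjoint[symmetric]) (auto intro!: sum.cong)
    have "0 \<le> sum (vec_nth x) ?B" by (simp add: sum_nonneg nonneg)
    then have "sum (vec_nth x) ?B = 0" "(\<Sum>j' | i \<in> rows j'. vec_nth x j') = 1"
      using split i(2) feas[of i] by linarith+
    then show ?thesis using i(1) by (auto simp: sum_nonneg_eq_0_iff nonneg)
  qed
  then show ?thesis using nonneg feas by (intro exI[of _ "vec_nth x"]) blast
qed

section \<open>Integral solutions of totally unimodular systems\<close>

text \<open>Induction on \<open>k\<close>: if every extension of a nonsingular minor by one more row were singular,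
  the cofactors along the new row would be a linear dependency of the columns.\<close>

lemma independent_columns_minor:
  fixes c :: "nat \<Rightarrow> 'w \<Rightarrow> 'a::comm_ring_1"
  assumes "\<And>\<delta>. (\<And>w. w \<in> T \<Longrightarrow> (\<Sum>j<k. \<delta> j * c j w) = 0) \<Longrightarrow> \<forall>j<k. \<delta> j = 0"
  shows "\<exists>r :: nat \<Rightarrow> 'w. r ` {..<k} \<subseteq> T \<and> det (mat k k (\<lambda>(i, j). c j (r i))) \<noteq> 0"
  using assms
proof (induction k)
  case 0
  then show ?case by (auto simp: det_def)
next
  case (Suc k)
  have "\<forall>j<k. \<delta> j = 0" if "\<And>w. w \<in> T \<Longrightarrow> (\<Sum>j<k. \<delta> j * c j w) = 0" for \<delta>
    using Suc.prems[of "\<lambda>j. if j < k then \<delta> j else 0"] that by (auto split: if_splits)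
  then obtain r :: "nat \<Rightarrow> 'w" where r: "r ` {..<k} \<subseteq> T"
    and det: "det (mat k k (\<lambda>(i, j). c j (r i))) \<noteq> 0"
    using Suc.IH by blast
  define A where "A w = mat (Suc k) (Suc k) (\<lambda>(i, j). c j ((r(k := w)) i))" for w
  have A: "A w \<in> carrier_mat (Suc k) (Suc k)" for w by (simp add: A_def)
  \<comment> \<open>Cofactors along row \<open>k\<close> do not involve that row, so
    \<open>undefined\<close> can stand for its index.\<close>
  define C where "C j = cofactor (A undefined) k j" for j
  have C: "cofactor (A w) k j = C j" for w j
    unfolding C_def cofactor_def mat_delete_def A_def
    by (intro arg_cong2[of _ _ _ _ "(*)"] refl arg_cong[of _ _ det]) (auto intro!: eq_matI)
  have "mat_delete (A undefined) k k = mat k k (\<lambda>(i, j). c j (r i))"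
    by (auto simp: mat_delete_def A_def intro!: eq_matI)
  then have "C k \<noteq> 0" using det by (simp add: C_def cofactor_def)
  then obtain w where w: "w \<in> T" "(\<Sum>j<Suc k. C j * c j w) \<noteq> 0"
    using Suc.prems[of C] by blast
  have "det (A w) = (\<Sum>j<Suc k. A w $$ (k, j) * cofactor (A w) k j)"
    by (rule laplace_expansion_row[OF A]) simp
  also have "\<dots> = (\<Sum>j<Suc k. C j * c j w)"
    unfolding C by (intro sum.cong refl) (simp add: A_def mult.commute)
  finally have "det (A w) \<noteq> 0" using w(2) by simp
  moreover have "(r(k := w)) ` {..<Suc k} \<subseteq> T" using r w(1) by (auto simp: less_Suc_eq)
  ultimately show ?case unfolding A_def by blast
qed

text \<open>Independence of the columns yields a nonsingular minor with rows in \<open>T\<close>;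
  its determinant is 1 or -1, so Cramer's rule divides an integer by a unit. Integer coefficients
  suffice in \<open>indep\<close>, because the dependency built from cofactors is integral.\<close>

lemma totally_unimodular_integral_solution:
  fixes c :: "nat \<Rightarrow> 'w \<Rightarrow> int" and y :: "nat \<Rightarrow> real"
  assumes V: "totally_unimodular V" "c ` {..<k} \<subseteq> V"
    and indep: "\<And>\<delta>. (\<And>w. w \<in> T \<Longrightarrow> (\<Sum>j<k. \<delta> j * c j w) = 0) \<Longrightarrow> \<forall>j<k. \<delta> j = 0"
    and sol: "\<And>w. w \<in> T \<Longrightarrow> (\<Sum>j<k. y j * of_int (c j w)) = of_int (b w)"
    and l: "l < k"
  shows "y l \<in> \<int>"
proof -
  obtain r :: "nat \<Rightarrow> 'w" where r: "r ` {..<k} \<subseteq> T"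
    and det: "det (mat k k (\<lambda>(i, j). c j (r i))) \<noteq> 0"
    using independent_columns_minor[of T c k] indep by metis
  define A where "A = mat k k (\<lambda>(i, j). c j (r i))"
  have A: "A \<in> carrier_mat k k" by (simp add: A_def)
  \<comment> \<open>\<open>totally_unimodular\<close> speaks only of distinct rows and columns; a
    repetition would make the determinant vanish.\<close>
  have "inj_on r {..<k}"
  proof (rule inj_onI, rule ccontr)
    fix i i' assume "i \<in> {..<k}" "i' \<in> {..<k}" "r i = r i'" "i \<noteq> i'"
    then have "det A = 0"
      by (intro det_identical_rows[OF A, of i i']) (auto simp: A_def intro!: eq_vecI)
    then show False using det by (simp add: A_def)
  qed
  moreover have "inj_on c {..<k}"
  proof (rule inj_onI, rule ccontr)
    fix i i' assume "i \<in> {..<k}" "i' \<in> {..<k}" "c i = c i'" "i \<noteq> i'"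
    then have "det A = 0"
      by (intro det_identical_columns[OF A, of i i']) (auto simp: A_def intro!: eq_vecI)
    then show False using det by (simp add: A_def)
  qed
  ultimately have "det A \<in> {-1, 0, 1}"
    using V unfolding totally_unimodular_def A_def by blast
  then have det1: "det A = 1 \<or> det A = -1" using det by (auto simp: A_def)
  define A' where "A' = map_mat real_of_int A"
  define v where "v = Matrix.vec k y"
  have A': "A' \<in> carrier_mat k k" using A by (simp add: A'_def)
  have "A' *\<^sub>v v = map_vec real_of_int (Matrix.vec k (\<lambda>i. b (r i)))"
  proof (rule eq_vecI)
    fix i assume "i < dim_vec (map_vec real_of_int (Matrix.vec k (\<lambda>i. b (r i))))"
    then have i: "i < k" by simp
    then have "(A' *\<^sub>v v) $ i = (\<Sum>j<k. y j * of_int (c j (r i)))"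
      by (auto simp: A'_def A_def v_def scalar_prod_def mult.commute atLeast0LessThan
          intro!: sum.cong)
    then show "(A' *\<^sub>v v) $ i = map_vec real_of_int (Matrix.vec k (\<lambda>i. b (r i))) $ i"
      using sol[of "r i"] r i by auto
  qed (simp add: A'_def A_def)
  then have "replace_col A' (A' *\<^sub>v v) l
      = map_mat real_of_int (replace_col A (Matrix.vec k (\<lambda>i. b (r i))) l)"
    using A by (auto simp: replace_col_def A'_def intro!: eq_matI)
  then have "y l * det A' = of_int (det (replace_col A (Matrix.vec k (\<lambda>i. b (r i))) l))"
    using cramer_lemma_mat[OF A' _ l, of v] l by (simp add: v_def of_int_hom.hom_det)
  then have "y l * det A' \<in> \<int>" by (metis Ints_of_int)
  moreover have "det A' = of_int (det A)" by (simp add: A'_def of_int_hom.hom_det)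
  ultimately show ?thesis using det1 by auto
qed

text \<open>The ratio test of the simplex method: \<open>t\<close> is the least ratio
  \<open>x a / - \<delta> a\<close> over the decreasing coordinates. A minimizing coordinate reaches
  0, and it was nonzero before because \<delta> vanishes wherever \<open>x\<close> does.\<close>

lemma positive_step_to_boundary:
  fixes x \<delta> :: "'a \<Rightarrow> real"
  assumes "finite A" "\<And>a. a \<in> A \<Longrightarrow> 0 \<le> x a" "\<And>a. a \<in> A \<Longrightarrow> x a = 0 \<Longrightarrow> \<delta> a = 0"
    and "b \<in> A" "\<delta> b < 0"
  shows "\<exists>t. (\<forall>a\<in>A. 0 \<le> x a + t * \<delta> a) \<and> (\<exists>a\<in>A. x a \<noteq> 0 \<and> x a + t * \<delta> a = 0)"
proof -
  let ?N = "{a \<in> A. \<delta> a < 0}"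
  define t where "t = Min ((\<lambda>a. x a / - \<delta> a) ` ?N)"
  have fin: "finite ?N" "?N \<noteq> {}" using assms by auto
  have "t \<in> (\<lambda>a. x a / - \<delta> a) ` ?N" unfolding t_def using fin by (intro Min_in) auto
  then obtain a where a: "a \<in> A" "\<delta> a < 0" "t = x a / - \<delta> a" by auto
  have "0 \<le> t" using a assms(2) by (simp add: divide_nonneg_neg)
  have "0 \<le> x a' + t * \<delta> a'" if "a' \<in> A" for a'
  proof (cases "\<delta> a' < 0")
    case True
    then have "t \<le> x a' / - \<delta> a'" unfolding t_def using that fin by (intro Min_le) auto
    then show ?thesis using True by (simp add: field_simps)
  next
    case False
    then show ?thesis using \<open>0 \<le> t\<close> assms(2)[OF that] by simp
  qed
  moreover have "x a \<noteq> 0" "x a + t * \<delta> a = 0" using a assms(3) by (auto simp: field_simps)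
  ultimately show ?thesis using a(1) by blast
qed


section \<open>Preferences and choices\<close>

lemma weak_pref_linear: "strict_total r \<Longrightarrow> weak_pref r x y \<or> weak_pref r y x"
  unfolding strict_total_def weak_pref_def total_on_def by blast

lemma weak_pref_trans: "strict_total r \<Longrightarrow> weak_pref r x y \<Longrightarrow> weak_pref r y z \<Longrightarrow> weak_pref r x z"
  unfolding strict_total_def weak_pref_def by (metis transD)

lemma weak_pref_antisym: "strict_total r \<Longrightarrow> weak_pref r x y \<Longrightarrow> weak_pref r y x \<Longrightarrow> x = y"
  unfolding strict_total_def weak_pref_def by (metis irrefl_def transD)

lemma strict_pref_iff_not_weak_pref: "strict_total r \<Longrightarrow> (x, y) \<in> r \<longleftrightarrow> \<not> weak_pref r y x"
  unfolding strict_total_def weak_pref_def by (metis irrefl_def transD total_on_def UNIV_I)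

lemma Ch_eqI:
  assumes "strict_total (prefF f)" "T \<subseteq> S" "\<And>T'. T' \<subseteq> S \<Longrightarrow> weak_pref (prefF f) T T'"
  shows "Ch prefF f S = T"
  unfolding Ch_def
proof (rule the_equality)
  show "T \<subseteq> S \<and> (\<forall>T'. T' \<subseteq> S \<longrightarrow> weak_pref (prefF f) T T')" using assms by blast
  fix M assume "M \<subseteq> S \<and> (\<forall>T'. T' \<subseteq> S \<longrightarrow> weak_pref (prefF f) M T')"
  then show "M = T" using assms(2,3) by (intro weak_pref_antisym[OF assms(1)]) auto
qed

lemma Ch_best:
  fixes prefF :: "'f \<Rightarrow> ('w::finite set \<times> 'w set) set"
  assumes "strict_total (prefF f)"
  shows "Ch prefF f S \<subseteq> S" "T \<subseteq> S \<Longrightarrow> weak_pref (prefF f) (Ch prefF f S) T"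
proof -
  have "\<exists>M\<in>Pow S. \<forall>T\<in>Pow S. weak_pref (prefF f) M T"
    using weak_pref_linear[OF assms] weak_pref_trans[OF assms]
    by (intro finite_total_preorder_greatest) auto
  then obtain M where M: "M \<subseteq> S" "\<And>T. T \<subseteq> S \<Longrightarrow> weak_pref (prefF f) M T" by blast
  then have "Ch prefF f S = M" by (intro Ch_eqI assms)
  then show "Ch prefF f S \<subseteq> S" "T \<subseteq> S \<Longrightarrow> weak_pref (prefF f) (Ch prefF f S) T"
    using M by auto
qed

section \<open>Fractional matchings\<close>

text \<open>A deal \<open>Inl (f, S)\<close> is firm \<open>f\<close> hiring exactly \<open>S\<close>, and \<open>Inr w\<close> is worker \<open>w\<close> remaining
  unmatched.\<close>

type_synonym ('f, 'w) deal = "('f \<times> 'w set) + 'w"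

fun agents :: "('f, 'w) deal \<Rightarrow> ('f + 'w) set" where
  "agents (Inl p) = insert (Inl (fst p)) (Inr ` snd p)"
| "agents (Inr w) = {Inr w}"

fun employer :: "('f, 'w) deal \<Rightarrow> 'f option" where
  "employer (Inl p) = Some (fst p)"
| "employer (Inr w) = None"

fun team :: "('f, 'w) deal \<Rightarrow> 'w set" where
  "team (Inl p) = snd p"
| "team (Inr w) = {}"

lemma finite_agents: "finite (agents (d :: ('f, 'w::finite) deal))"
  by (cases d) auto

lemma sum_firm_deals:
  fixes x :: "('f::finite, 'w::finite) deal \<Rightarrow> real"
  shows "(\<Sum>d | Inl f \<in> agents d. x d) = (\<Sum>S\<in>UNIV. x (Inl (f, S)))"
proof -
  have "{d. Inl f \<in> agents d} = (\<lambda>S. Inl (f, S)) ` (UNIV :: 'w set set)"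
  proof (rule Set.set_eqI)
    fix d :: "('f, 'w) deal"
    show "d \<in> {d. Inl f \<in> agents d} \<longleftrightarrow> d \<in> (\<lambda>S. Inl (f, S)) ` UNIV"
      by (cases d) (auto simp: image_iff prod_eq_iff)
  qed
  then show ?thesis by (simp add: sum.reindex inj_on_def)
qed

lemma sum_worker_deals:
  fixes x :: "('f::finite, 'w::finite) deal \<Rightarrow> real"
  shows "(\<Sum>d | Inr w \<in> agents d. x d) = x (Inr w) + (\<Sum>p\<in>UNIV. x (Inl p) * of_int (ind (snd p) w))"
proof -
  have "{d. Inr w \<in> agents d} = insert (Inr w) (Inl ` {p :: 'f \<times> 'w set. w \<in> snd p})"
  proof (rule Set.set_eqI)
    fix d :: "('f, 'w) deal"
    show "d \<in> {d. Inr w \<in> agents d} \<longleftrightarrow> d \<in> insert (Inr w) (Inl ` {p. w \<in> snd p})"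
      by (cases d) auto
  qed
  then have "(\<Sum>d | Inr w \<in> agents d. x d) = x (Inr w) + (\<Sum>p | w \<in> snd p. x (Inl p))"
    by (simp add: sum.reindex image_iff)
  also have "(\<Sum>p | w \<in> snd p. x (Inl p)) = (\<Sum>p\<in>UNIV. x (Inl p) * of_int (ind (snd p) w))"
    by (rule sum.mono_neutral_cong_left) (auto simp: ind_def)
  finally show ?thesis .
qed

section \<open>Preferences over deals and fractional stability\<close>

locale matching_market =
  fixes prefW :: "'w::finite \<Rightarrow> ('f::finite option \<times> 'f option) set"
    and prefF :: "'f \<Rightarrow> ('w set \<times> 'w set) set"
  assumes strictW: "strict_total (prefW w)"
    and strictF: "strict_total (prefF f)"
begin

text \<open>A worker breaks ties between two deals of the same firm by the preference of that firm; with
  any other tie-breaking rule the teams in the support would not be choices of the firm.\<close>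

fun weakly_worse :: "'f + 'w \<Rightarrow> ('f, 'w) deal \<Rightarrow> ('f, 'w) deal \<Rightarrow> bool" where
  "weakly_worse (Inl f) d d' \<longleftrightarrow> weak_pref (prefF f) (team d') (team d)"
| "weakly_worse (Inr w) d d' \<longleftrightarrow> (employer d', employer d) \<in> prefW w \<or>
     employer d' = employer d \<and>
     (\<forall>f. employer d = Some f \<longrightarrow> weak_pref (prefF f) (team d') (team d))"

lemma weakly_worse_linear: "weakly_worse i d d' \<or> weakly_worse i d' d"
proof (cases i)
  case (Inl f)
  then show ?thesis using weak_pref_linear[OF strictF] by simp
next
  case (Inr w)
  then show ?thesis
    using weak_pref_linear[OF strictF] weak_pref_linear[OF strictW, of w "employer d" "employer d'"]
    by (cases "employer d") (auto simp: weak_pref_def[of "prefW w"], metis+)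
qed

lemma weakly_worse_trans: "weakly_worse i d d' \<Longrightarrow> weakly_worse i d' d'' \<Longrightarrow> weakly_worse i d d''"
proof (cases i)
  case (Inl f)
  then show "weakly_worse i d d' \<Longrightarrow> weakly_worse i d' d'' \<Longrightarrow> weakly_worse i d d''"
    using weak_pref_trans[OF strictF] by auto
next
  case (Inr w)
  have "trans (prefW w)" using strictW by (simp add: strict_total_def)
  then show "weakly_worse i d d' \<Longrightarrow> weakly_worse i d' d'' \<Longrightarrow> weakly_worse i d d''"
    using Inr weak_pref_trans[OF strictF] by (auto dest: transD)
qed

lemma weakly_worse_refl: "weakly_worse i d d"
  using weakly_worse_linear by blast

text \<open>The last clause is dominance as in Scarf's lemma: each deal has a participant whose
  support deals are all at least as good. It depends on \<open>x\<close> only through the support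
  and survives shrinking it.\<close>

definition fractionally_stable :: "(('f, 'w) deal \<Rightarrow> real) \<Rightarrow> bool" where
  "fractionally_stable x \<longleftrightarrow> (\<forall>d. 0 \<le> x d) \<and> (\<forall>i. (\<Sum>d | i \<in> agents d. x d) = 1) \<and>
     (\<forall>d. \<exists>i\<in>agents d. \<forall>d'. i \<in> agents d' \<and> x d' \<noteq> 0 \<longrightarrow> weakly_worse i d d')"

lemma exists_fractionally_stable: "\<exists>x. fractionally_stable x"
proof -
  have "agents d \<noteq> {}" for d :: "('f, 'w) deal" by (cases d) auto
  then have "\<exists>x :: ('f, 'w) deal \<Rightarrow> real. (\<forall>d. 0 \<le> x d) \<and>
    (\<forall>i. (\<Sum>d | i \<in> agents d. x d) \<le> 1) \<and>
    (\<forall>d. \<exists>i\<in>agents d. (\<Sum>d' | i \<in> agents d'. x d') = 1 \<and>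
      (\<forall>d'. i \<in> agents d' \<and> x d' \<noteq> 0 \<longrightarrow> weakly_worse i d d'))"
    by (rule exists_fractional_stable[OF finite_agents])
      (rule weakly_worse_linear, erule (1) weakly_worse_trans)
  then obtain x :: "('f, 'w) deal \<Rightarrow> real" where nonneg: "\<forall>d. 0 \<le> x d"
    and dom: "\<forall>d. \<exists>i\<in>agents d. (\<Sum>d' | i \<in> agents d'. x d') = 1 \<and>
      (\<forall>d'. i \<in> agents d' \<and> x d' \<noteq> 0 \<longrightarrow> weakly_worse i d d')"
    by blast
  \<comment> \<open>Deals with one participant, \<open>Inl (f, {})\<close> and \<open>Inr w\<close>,
    can only be dominated by that participant, whose constraint is therefore tight.\<close>
  have "(\<Sum>d | i \<in> agents d. x d) = 1" for i
  proof (cases i)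
    case (Inl f)
    then show ?thesis using dom[rule_format, of "Inl (f, {})"] by auto
  next
    case (Inr w)
    then show ?thesis using dom[rule_format, of "Inr w"] by auto
  qed
  then show ?thesis using nonneg dom unfolding fractionally_stable_def by blast
qed

section \<open>Basic solutions\<close>

text \<open>As in linear programming: the columns of the feasibility system at the support of
  \<open>x\<close> are linearly independent.\<close>

definition basic :: "(('f, 'w) deal \<Rightarrow> real) \<Rightarrow> bool" where
  "basic x \<longleftrightarrow> (\<forall>\<delta> :: ('f, 'w) deal \<Rightarrow> real. (\<forall>d. x d = 0 \<longrightarrow> \<delta> d = 0) \<longrightarrow>
     (\<forall>i. (\<Sum>d | i \<in> agents d. \<delta> d) = 0) \<longrightarrow> (\<forall>d. \<delta> d = 0))"

text \<open>Take a support of least size. Following a nonzero \<delta> that violates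
  \<open>basic\<close> until a support coordinate vanishes keeps the feasibility equations, and
  dominance passes to the smaller support, contradicting minimality.\<close>

lemma exists_basic_fractionally_stable: "\<exists>x. fractionally_stable x \<and> basic x"
proof -
  obtain x where x: "fractionally_stable x"
    and least: "\<And>y. fractionally_stable y \<Longrightarrow> card {d. x d \<noteq> 0} \<le> card {d. y d \<noteq> 0}"
    using exists_fractionally_stable
      ex_has_least_nat[of fractionally_stable _ "\<lambda>x. card {d. x d \<noteq> 0}"] by blast
  have "\<delta> d = 0"
    if supp: "\<forall>d. x d = 0 \<longrightarrow> \<delta> d = 0" and zero: "\<forall>i. (\<Sum>d | i \<in> agents d. \<delta> d) = 0"
    for \<delta> :: "('f, 'w) deal \<Rightarrow> real" and d
  proof (rule ccontr)
    assume d: "\<delta> d \<noteq> 0"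
    have "\<exists>b. \<delta> b < 0"
    proof (rule ccontr)
      assume "\<nexists>b. \<delta> b < 0"
      then have nn: "\<And>b. 0 \<le> \<delta> b" by (meson not_le)
      obtain i where "i \<in> agents d" by (cases d) auto
      then show False using d zero[rule_format, of i] nn by (auto simp: sum_nonneg_eq_0_iff)
    qed
    then obtain b where "\<delta> b < 0" by blast
    then obtain t d0 where t: "\<And>d. 0 \<le> x d + t * \<delta> d" and d0: "x d0 \<noteq> 0" "x d0 + t * \<delta> d0 = 0"
      using positive_step_to_boundary[of UNIV x \<delta> b] x supp
      by (auto simp: fractionally_stable_def)
    define y where "y d = x d + t * \<delta> d" for d
    have sub: "y d \<noteq> 0 \<Longrightarrow> x d \<noteq> 0" for d using supp by (auto simp: y_def)
    have "(\<Sum>d | i \<in> agents d. y d) = 1" for i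
      using x zero by (simp add: y_def sum.distrib sum_distrib_left[symmetric] fractionally_stable_def)
    then have "fractionally_stable y"
      using x t sub unfolding fractionally_stable_def y_def[symmetric] by meson
    moreover have "{d. y d \<noteq> 0} \<subset> {d. x d \<noteq> 0}" using sub d0 by (auto simp: y_def)
    ultimately show False
      using least[of y] psubset_card_mono[of "{d. x d \<noteq> 0}" "{d. y d \<noteq> 0}"] by simp
  qed
  then show ?thesis using x unfolding basic_def by blast
qed

section \<open>Teams in the support as choices from a chain\<close>

text \<open>The workers whom \<open>f\<close> could attract at the level of \<open>S\<close>. They
  need not belong to \<open>S\<close>: the deal \<open>Inl (f, S)\<close> serves only as a
  threshold.\<close>

definition available :: "(('f, 'w) deal \<Rightarrow> real) \<Rightarrow> 'f \<Rightarrow> 'w set \<Rightarrow> 'w set" where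
  "available x f S = {w. \<exists>d. x d \<noteq> 0 \<and> Inr w \<in> agents d \<and> weakly_worse (Inr w) d (Inl (f, S))}"

text \<open>Consider the participant dominating \<open>Inl (f, T)\<close>. If it is
  \<open>f\<close>, then \<open>S\<close> is at least as good as \<open>T\<close> directly. If it is
  a worker in \<open>T\<close>, a support deal of that worker lies between \<open>Inl (f, T)\<close>
  and \<open>Inl (f, S)\<close>; both ends have employer \<open>f\<close>, so the tie-breaking rule
  compares the teams.\<close>

lemma Ch_available:
  assumes x: "fractionally_stable x" and S: "x (Inl (f, S)) \<noteq> 0"
  shows "Ch prefF f (available x f S) = S"
proof (rule Ch_eqI)
  show "strict_total (prefF f)" by (rule strictF)
  show "S \<subseteq> available x f S"
  proof
    fix w assume "w \<in> S"
    then show "w \<in> available x f S"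
      unfolding available_def using S weakly_worse_refl by (intro CollectI exI[of _ "Inl (f, S)"]) auto
  qed
  fix T assume T: "T \<subseteq> available x f S"
  obtain i where i: "i \<in> agents (Inl (f, T))"
    "\<And>d. i \<in> agents d \<Longrightarrow> x d \<noteq> 0 \<Longrightarrow> weakly_worse i (Inl (f, T)) d"
    using x unfolding fractionally_stable_def by blast
  show "weak_pref (prefF f) S T"
  proof (cases i)
    case (Inl f')
    then show ?thesis using i(1) i(2)[of "Inl (f, S)"] S by auto
  next
    case (Inr w)
    then have "w \<in> T" using i(1) by auto
    then obtain d where d: "x d \<noteq> 0" "Inr w \<in> agents d" "weakly_worse (Inr w) d (Inl (f, S))"
      using T by (auto simp: available_def)
    then have "weakly_worse (Inr w) (Inl (f, T)) (Inl (f, S))"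
      using i(2)[of d] Inr weakly_worse_trans by blast
    then show ?thesis using strictW[of w] by (simp add: strict_total_def irrefl_def)
  qed
qed

lemma available_mono:
  assumes "weak_pref (prefF f) S S'"
  shows "available x f S' \<subseteq> available x f S"
proof -
  have "weakly_worse (Inr w) (Inl (f, S')) (Inl (f, S))" for w using assms by simp
  then show ?thesis unfolding available_def using weakly_worse_trans by blast
qed

text \<open>The better team is the choice from the larger available set, hence the order of
  subtraction; the inclusion is strict since equal sets would give equal choices.\<close>

lemma support_difference_in_demand_type:
  assumes x: "fractionally_stable x" "x (Inl (f, S)) \<noteq> 0" "x (Inl (f, S')) \<noteq> 0"
    and "weak_pref (prefF f) S S'" "S \<noteq> S'"
  shows "(\<lambda>w. ind S w - ind S' w) \<in> demand_type prefF"
proof -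
  have "available x f S' \<subset> available x f S"
    using available_mono[OF assms(4)] Ch_available[OF x(1)] x(2,3) \<open>S \<noteq> S'\<close> by (metis psubsetI)
  moreover have "(\<lambda>w. ind S w - ind S' w) \<noteq> (\<lambda>_. 0)"
  proof
    assume "(\<lambda>w. ind S w - ind S' w) = (\<lambda>_. 0)"
    then have "w \<in> S \<longleftrightarrow> w \<in> S'" for w
      by (drule_tac fun_cong[of _ _ w]) (auto simp: ind_def split: if_splits)
    then show False using \<open>S \<noteq> S'\<close> by blast
  qed
  ultimately show ?thesis
    unfolding demand_type_def demand_type_firm_def
    using Ch_available[OF x(1)] x(2,3)
    by (intro UN_I[of f] CollectI conjI exI[of _ "available x f S"] exI[of _ "available x f S'"])
      (auto simp: ind_def)
qed

section \<open>Integrality of basic solutions\<close>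

text \<open>Eliminating the mass of \<open>L f\<close> by the equation of \<open>f\<close> leaves
  the masses on \<open>M\<close> as unknowns of a system with columns
  \<open>ind S - ind (L f)\<close> and one equation for each worker with no unmatched mass.\<close>

lemma basic_support_unique:
  assumes x: "fractionally_stable x" and basic: "basic x"
    and tu: "totally_unimodular (demand_type prefF)"
  obtains L where "\<And>f S. x (Inl (f, S)) \<noteq> 0 \<longleftrightarrow> S = L f"
proof -
  have nonneg: "0 \<le> x d" and tight: "(\<Sum>d | i \<in> agents d. x d) = 1" for d i
    using x by (auto simp: fractionally_stable_def)
  have firm1: "(\<Sum>S\<in>UNIV. x (Inl (f, S))) = 1" for f
    using tight[of "Inl f"] by (simp add: sum_firm_deals)
  have "\<exists>L. x (Inl (f, L)) \<noteq> 0 \<and> (\<forall>S. x (Inl (f, S)) \<noteq> 0 \<longrightarrow> weak_pref (prefF f) S L)" for f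
  proof -
    have "{S. x (Inl (f, S)) \<noteq> 0} \<noteq> {}"
    proof
      assume "{S. x (Inl (f, S)) \<noteq> 0} = {}"
      then have "(\<Sum>S\<in>UNIV. x (Inl (f, S))) = 0" by (intro sum.neutral) auto
      then show False using firm1 by simp
    qed
    then have "\<exists>L\<in>{S. x (Inl (f, S)) \<noteq> 0}. \<forall>S\<in>{S. x (Inl (f, S)) \<noteq> 0}. weak_pref (prefF f) S L"
      using weak_pref_linear[OF strictF] weak_pref_trans[OF strictF]
      by (intro finite_total_preorder_greatest) auto
    then show ?thesis by auto
  qed
  then obtain L where L: "x (Inl (f, L f)) \<noteq> 0"
    and L_worst: "x (Inl (f, S)) \<noteq> 0 \<Longrightarrow> weak_pref (prefF f) S (L f)" for f S
    by metis
  define M where "M = {p. x (Inl p) \<noteq> 0 \<and> snd p \<noteq> L (fst p)}"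
  define k where "k = card M"
  obtain e where e: "bij_betw e {..<k} M"
    using ex_bij_betw_nat_finite[of M] by (auto simp: k_def atLeast0LessThan)
  define D where "D p w = ind (snd p) w - ind (L (fst p)) w" for p w
  define c where "c j = D (e j)" for j
  \<comment> \<open>At any other worker, \<open>x (Inr w)\<close> is a slack that absorbs changes,
    so that equation is dropped.\<close>
  define T where "T = {w. x (Inr w) = 0}"
  have eM: "e j \<in> M" if "j < k" for j using e that by (auto simp: bij_betw_def)
  have "D p \<in> demand_type prefF" if "p \<in> M" for p
    using that support_difference_in_demand_type[OF x, of "fst p" "snd p" "L (fst p)"]
      L[of "fst p"] L_worst[of "fst p" "snd p"]
    by (simp add: D_def[abs_def] M_def)
  then have c: "c ` {..<k} \<subseteq> demand_type prefF" using eM by (simp add: c_def image_subset_iff)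
  \<comment> \<open>A dependency \<beta> among the columns lifts to a null vector \<delta> of the
    full system that vanishes off the support of \<open>x\<close>, and \<open>basic\<close> forces
    it to be 0.\<close>
  have indep: "\<forall>j<k. \<beta> j = 0" if \<beta>: "\<And>w. w \<in> T \<Longrightarrow> (\<Sum>j<k. \<beta> j * c j w) = 0" for \<beta> :: "nat \<Rightarrow> int"
  proof -
    define \<eta> where "\<eta> p = (if p \<in> M then real_of_int (\<beta> (the_inv_into {..<k} e p)) else 0)" for p
    have \<eta>_e: "\<eta> (e j) = \<beta> j" if "j < k" for j
      using that eM e by (simp add: \<eta>_def the_inv_into_f_f bij_betw_def)
    \<comment> \<open>\<open>L f\<close> receives minus the total of \<eta> over \<open>f\<close>,
      so each firm's sum vanishes. The coordinates \<open>Inr w\<close> of \<delta> then cancel the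
      workers' sums; on \<open>T\<close> they are 0 by the assumption on \<beta>.\<close>
    define \<delta>f where "\<delta>f p = \<eta> p - (if snd p = L (fst p) then \<Sum>S\<in>UNIV. \<eta> (fst p, S) else 0)" for p
    define \<delta> where "\<delta> d = (case d of Inl p \<Rightarrow> \<delta>f p
        | Inr w \<Rightarrow> - (\<Sum>p\<in>UNIV. \<delta>f p * of_int (ind (snd p) w)))" for d
    have firm0: "(\<Sum>S\<in>UNIV. \<delta>f (f, S)) = 0" for f
      by (simp add: \<delta>f_def sum_subtractf sum.delta)
    have worker: "(\<Sum>p\<in>UNIV. \<delta>f p * of_int (ind (snd p) w)) = (\<Sum>j<k. \<beta> j * c j w)" for w
    proof -
      have "(\<Sum>p\<in>UNIV. \<delta>f p * of_int (ind (snd p) w))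
          = (\<Sum>f\<in>UNIV. \<Sum>S\<in>UNIV. \<delta>f (f, S) * of_int (ind S w))"
        by (simp add: sum.cartesian_product case_prod_unfold)
      also have "\<dots> = (\<Sum>f\<in>UNIV. \<Sum>S\<in>UNIV. \<eta> (f, S) * of_int (D (f, S) w))"
      proof (rule sum.cong[OF refl])
        fix f
        have "(\<Sum>S\<in>UNIV. \<delta>f (f, S) * of_int (ind S w))
            = (\<Sum>S\<in>UNIV. \<eta> (f, S) * of_int (ind S w))
              - (\<Sum>S\<in>UNIV. if S = L f then (\<Sum>S\<in>UNIV. \<eta> (f, S)) * of_int (ind S w) else 0)"
          unfolding sum_subtractf[symmetric]
          by (intro sum.cong refl) (simp add: \<delta>f_def algebra_simps)
        then show "(\<Sum>S\<in>UNIV. \<delta>f (f, S) * of_int (ind S w)) = (\<Sum>S\<in>UNIV. \<eta> (f, S) * of_int (D (f, S) w))"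
          by (simp add: sum.delta D_def algebra_simps sum_subtractf sum_distrib_left sum_distrib_right)
      qed
      also have "\<dots> = (\<Sum>p\<in>UNIV. \<eta> p * of_int (D p w))"
        by (simp add: sum.cartesian_product case_prod_unfold)
      also have "\<dots> = (\<Sum>p\<in>M. \<eta> p * of_int (D p w))"
        by (rule sum.mono_neutral_right) (auto simp: \<eta>_def)
      also have "\<dots> = (\<Sum>j<k. \<eta> (e j) * of_int (D (e j) w))"
        by (rule sum.reindex_bij_betw[OF e, symmetric])
      also have "\<dots> = (\<Sum>j<k. \<beta> j * c j w)" by (simp add: \<eta>_e c_def)
      finally show ?thesis .
    qed
    have "\<delta> d = 0" if "x d = 0" for d
    proof (cases d)
      case (Inl p)
      then show ?thesis using that L by (cases p) (auto simp: \<delta>_def \<delta>f_def \<eta>_def M_def)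
    next
      case (Inr w)
      then show ?thesis using that worker[of w] \<beta>[of w] by (simp add: \<delta>_def T_def)
    qed
    moreover have "(\<Sum>d | i \<in> agents d. \<delta> d) = 0" for i
      by (cases i) (simp_all add: sum_firm_deals sum_worker_deals \<delta>_def firm0)
    ultimately have \<delta>0: "\<delta> d = 0" for d using basic unfolding basic_def by blast
    have "\<beta> j = 0" if "j < k" for j
      using \<delta>0[of "Inl (e j)"] eM[OF that] \<eta>_e[OF that] by (simp add: \<delta>_def \<delta>f_def M_def)
    then show ?thesis by blast
  qed
  have sol: "(\<Sum>j<k. x (Inl (e j)) * of_int (c j w)) = of_int (1 - (\<Sum>f\<in>UNIV. ind (L f) w))"
    if "w \<in> T" for w
  proof -
    have "(\<Sum>j<k. x (Inl (e j)) * of_int (c j w)) = (\<Sum>p\<in>M. x (Inl p) * of_int (D p w))"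
      unfolding c_def by (rule sum.reindex_bij_betw[OF e])
    \<comment> \<open>Outside \<open>M\<close> each term vanishes: either the mass is 0 or the team
      is \<open>L f\<close>, where \<open>D\<close> is 0.\<close>
    also have "\<dots> = (\<Sum>p\<in>UNIV. x (Inl p) * of_int (D p w))"
      by (rule sum.mono_neutral_left) (auto simp: M_def D_def)
    also have "\<dots> = (\<Sum>p\<in>UNIV. x (Inl p) * of_int (ind (snd p) w))
        - (\<Sum>p\<in>UNIV. x (Inl p) * of_int (ind (L (fst p)) w))"
      by (simp add: D_def algebra_simps sum_subtractf)
    also have "(\<Sum>p\<in>UNIV. x (Inl p) * of_int (ind (snd p) w)) = 1"
      using tight[of "Inr w"] that by (simp add: sum_worker_deals T_def)
    also have "(\<Sum>p\<in>UNIV. x (Inl p) * of_int (ind (L (fst p)) w))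
        = (\<Sum>f\<in>UNIV. (\<Sum>S\<in>UNIV. x (Inl (f, S))) * of_int (ind (L f) w))"
      by (simp add: sum_distrib_right sum.cartesian_product case_prod_unfold)
    finally show ?thesis by (simp add: firm1)
  qed
  have int: "x (Inl (e j)) \<in> \<int>" if "j < k" for j
    by (rule totally_unimodular_integral_solution[where T = T and y = "\<lambda>j. x (Inl (e j))", OF tu c])
      (rule indep, assumption, rule sol, assumption, rule that)
  have "M = {}"
  proof (rule ccontr)
    assume "M \<noteq> {}"
    then obtain j where j: "j < k" using e by (auto simp: bij_betw_def)
    obtain f S where fS: "e j = (f, S)" by fastforce
    have S: "x (Inl (f, S)) \<noteq> 0" "S \<noteq> L f" using eM[OF j] fS by (auto simp: M_def)
    have "(\<Sum>S'\<in>{S, L f}. x (Inl (f, S'))) \<le> (\<Sum>S'\<in>UNIV. x (Inl (f, S')))"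
      by (rule sum_mono2) (auto simp: nonneg)
    then have "x (Inl (f, S)) + x (Inl (f, L f)) \<le> 1" using S(2) firm1 by simp
    then have "x (Inl (f, S)) < 1" using L[of f] nonneg[of "Inl (f, L f)"] by linarith
    moreover have "0 < x (Inl (f, S))" using S(1) nonneg[of "Inl (f, S)"] by linarith
    moreover have "x (Inl (f, S)) \<in> \<int>" using int[OF j] fS by simp
    ultimately show False by (auto elim!: Ints_cases)
  qed
  then have "x (Inl (f, S)) \<noteq> 0 \<longleftrightarrow> S = L f" for f S
    using L by (auto simp: M_def)
  then show ?thesis by (rule that)
qed

section \<open>From a single team per firm to a stable matching\<close>

text \<open>Each \<open>L f\<close> has mass 1 and exhausts the equations of its workers, so the
  teams are disjoint and define a matching; dominance of every deal excludes blocking.\<close>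

lemma stable_of_unique_support:
  assumes x: "fractionally_stable x" and L: "\<And>f S. x (Inl (f, S)) \<noteq> 0 \<longleftrightarrow> S = L f"
  shows "\<exists>\<mu>. stable prefW prefF \<mu>"
proof -
  have nonneg: "0 \<le> x d" and tight: "(\<Sum>d | i \<in> agents d. x d) = 1" for d i
    using x by (auto simp: fractionally_stable_def)
  have one: "x (Inl (f, L f)) = 1" for f
  proof -
    have "(\<Sum>S\<in>UNIV. x (Inl (f, S))) = (\<Sum>S\<in>{L f}. x (Inl (f, S)))"
      by (rule sum.mono_neutral_right) (use L in auto)
    then show ?thesis using tight[of "Inl f"] by (simp add: sum_firm_deals)
  qed
  have only: "x d = 0" if w: "w \<in> L f" "Inr w \<in> agents d" "d \<noteq> Inl (f, L f)" for w f d
  proof -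
    have "(\<Sum>d'\<in>{d, Inl (f, L f)}. x d') \<le> (\<Sum>d' | Inr w \<in> agents d'. x d')"
      by (rule sum_mono2) (use w nonneg in auto)
    then show ?thesis using w(3) tight[of "Inr w"] one[of f] nonneg[of d] by simp
  qed
  define \<mu> where "\<mu> w = (if \<exists>f. w \<in> L f then Some (THE f. w \<in> L f) else None)" for w
  have uniq: "f = f'" if "w \<in> L f" "w \<in> L f'" for w f f'
    using only[of w f "Inl (f', L f')"] that L by auto
  have \<mu>: "\<mu> w = Some f \<longleftrightarrow> w \<in> L f" for w f
  proof -
    have "(THE f. w \<in> L f) = f'" if "w \<in> L f'" for f'
      using that uniq by (intro the_equality) auto
    then show ?thesis by (auto simp: \<mu>_def)
  qed
  have assigned: "assigned \<mu> f = L f" for f by (simp add: assigned_def \<mu>)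
  have dom: "\<exists>i\<in>agents d. \<forall>d'. i \<in> agents d' \<and> x d' \<noteq> 0 \<longrightarrow> weakly_worse i d d'" for d
    using x by (simp add: fractionally_stable_def)
  have acceptable: "weak_pref (prefW w) (\<mu> w) None" for w
  proof (cases "\<mu> w")
    case (Some f)
    then have "Inr w \<in> agents (Inl (f, L f))" "x (Inl (f, L f)) \<noteq> 0" using \<mu> L by auto
    then have "weakly_worse (Inr w) (Inr w) (Inl (f, L f))"
      using dom[of "Inr w"] by (simp del: weakly_worse.simps)
    then show ?thesis using Some by (simp add: weak_pref_def)
  qed (simp add: weak_pref_def)
  have "Ch prefF f (L f) = L f" for f
  proof (rule Ch_eqI)
    show "strict_total (prefF f)" by (rule strictF)
    fix T assume T: "T \<subseteq> L f"
    \<comment> \<open>\<open>L f\<close> is best among the subsets of a set containing it, hence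
      among its own subsets.\<close>
    have Ch: "Ch prefF f (available x f (L f)) = L f" using Ch_available[OF x] L by blast
    then have "T \<subseteq> available x f (L f)"
      using Ch_best(1)[of prefF f "available x f (L f)"] strictF[of f] T by simp
    then show "weak_pref (prefF f) (L f) T"
      using Ch_best(2)[of prefF f T "available x f (L f)"] strictF[of f] Ch by simp
  qed simp
  moreover have "\<not> blocking_coalition prefW prefF \<mu> f S" for f S
  proof
    assume "blocking_coalition prefW prefF \<mu> f S"
    then have S: "\<And>w. w \<in> S \<Longrightarrow> weak_pref (prefW w) (Some f) (\<mu> w)"
      and better: "\<not> weak_pref (prefF f) (L f) S"
      using strict_pref_iff_not_weak_pref[OF strictF] by (auto simp: blocking_coalition_def assigned)
    obtain i where i: "i \<in> agents (Inl (f, S))"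
      "\<And>d. i \<in> agents d \<Longrightarrow> x d \<noteq> 0 \<Longrightarrow> weakly_worse i (Inl (f, S)) d"
      using dom[of "Inl (f, S)"] by blast
    show False
    proof (cases i)
      case (Inl f')
      then show False using i(1) i(2)[of "Inl (f, L f)"] L better by auto
    next
      case (Inr w)
      then have w: "w \<in> S" using i(1) by auto
      obtain d where d: "Inr w \<in> agents d" "x d \<noteq> 0"
      proof -
        have "\<exists>d. Inr w \<in> agents d \<and> x d \<noteq> 0"
        proof (rule ccontr)
          assume "\<not> ?thesis"
          then have "(\<Sum>d | Inr w \<in> agents d. x d) = 0" by (intro sum.neutral) auto
          then show False using tight by simp
        qed
        then show ?thesis using that by blast
      qed
      have d_eq: "employer d = \<mu> w" "employer d = Some f \<longrightarrow> team d = L f"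
      proof -
        show "employer d = \<mu> w"
        proof (cases d)
          case (Inl p)
          then show ?thesis using d L[of "fst p" "snd p"] \<mu>[of w "fst p"] by auto
        next
          case (Inr w')
          then have "w \<notin> L f'" for f' using d only[of w f' d] by auto
          then show ?thesis using Inr by (simp add: \<mu>_def)
        qed
        show "employer d = Some f \<longrightarrow> team d = L f"
          using d(2) L by (cases d) auto
      qed
      \<comment> \<open>A tie at employer \<open>f\<close> would make \<open>L f\<close> at least as
        good as \<open>S\<close>, against \<open>better\<close>; so \<open>w\<close> strictly
        prefers \<open>\<mu> w\<close> to \<open>f\<close>, against blocking.\<close>
      have "weakly_worse (Inr w) (Inl (f, S)) d" using i(2) Inr d by blast
      then have "(\<mu> w, Some f) \<in> prefW w"
        using d_eq better by auto
      then show False using S[OF w] strict_pref_iff_not_weak_pref[OF strictW] by blast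
    qed
  qed
  ultimately have "stable prefW prefF \<mu>"
    using acceptable by (simp add: stable_def individually_rational_def assigned)
  then show ?thesis by blast
qed

end

theorem theorem1:
  fixes prefW :: "'w::finite \<Rightarrow> ('f::finite option \<times> 'f option) set"
    and prefF :: "'f \<Rightarrow> ('w set \<times> 'w set) set"
  assumes "\<And>w. strict_total (prefW w)"
    and "\<And>f. strict_total (prefF f)"
    and "totally_unimodular (demand_type prefF)"
  shows "\<exists>\<mu> :: 'w \<Rightarrow> 'f option. stable prefW prefF \<mu>"
proof -
  interpret matching_market prefW prefF by unfold_locales (rule assms(1,2))+
  obtain x where x: "fractionally_stable x" "basic x"
    using exists_basic_fractionally_stable by blast
  obtain L where "\<And>f S. x (Inl (f, S)) \<noteq> 0 \<longleftrightarrow> S = L f"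
    using basic_support_unique[OF x assms(3)] by metis
  then show ?thesis by (rule stable_of_unique_support[OF x(1)])
qed

end
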